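(* Let $r\in\mathbb N$, let $f,g_i,h_i\in\mathcal A$ for $i=1,\dots,r$, and let $L'u=f^2\,Lu+f\sum_{i=1}^rg_i\,\Gamma(h_i,u)$. Let $N\in[1,\infty)$ and $k:X\to\mathbb R$, and assume that $L$ satisfies the $\mathrm{BE}(k,N)$-condition. Then for every $N'\in(N,\infty]$ the operator $L'$ satisfies the $\mathrm{BE}(k',N')$-condition with $$\begin{aligned}k'=\ & f^2k+\frac12Lf^2-2\Gamma(f)+\sum_ig_i\,\Gamma(h_i,f)\\&+\inf_{u\in\mathcal A}\frac1{\Gamma(u)}\Big[-\frac1{N'-N}\Big((N-2)\Gamma(f,u)+\sum_ig_i\,\Gamma(h_i,u)\Big)^2-(N-2)\Gamma(f,u)^2\\&\qquad\qquad\quad-\sum_ifg_i\,H_{h_i}(u,u)-\sum_i\Gamma(fg_i,u)\,\Gamma(h_i,u)\Big],\end{aligned}$$ where at each $x\in X$ the infimum is over those $u\in\mathcal A$ with $\Gamma(u)(x)>0$.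
   Context: Let $X$ be a set, $\mathcal A$ an algebra of real-valued functions on $X$ and $L:\mathcal A\to\mathcal A$ a linear operator. Put $\Gamma(f,g)=\frac12[L(fg)-fLg-gLf]$ and $\Gamma(f)=\Gamma(f,f)$. $L$ is assumed to be a diffusion operator: $\Gamma(f)\ge0$ for all $f\in\mathcal A$, and for all $r$, all $f_1,\dots,f_r\in\mathcal A$ and every $C^\infty$ function $\psi:\mathbb R^r\to\mathbb R$ with $\psi(0)=0$ one has $\psi(f_1,\dots,f_r)\in\mathcal A$ and $L\psi(f_1,\dots,f_r)=\sum_i\psi_i(f_1,\dots,f_r)\,Lf_i+\sum_{i,j}\psi_{ij}(f_1,\dots,f_r)\,\Gamma(f_i,f_j)$, where $\psi_i,\psi_{ij}$ are partial derivatives. $L,\Gamma$ are extended to the algebra generated by $\mathcal A$ and the constants by $L1=0$, $\Gamma(1,f)=0$. Define $\Gamma_2(f,g)=\frac12[L\Gamma(f,g)-\Gamma(f,Lg)-\Gamma(g,Lf)]$, $\Gamma_2(f)=\Gamma_2(f,f)$, and the Hessian $H_f(g,h)=\frac12[\Gamma(g,\Gamma(f,h))+\Gamma(h,\Gamma(f,g))-\Gamma(f,\Gamma(g,h))]$. Bakry–Émery condition: $L$ satisfies $\mathrm{BE}(k,N)$, for a function $k$ on $X$ and $N\in[1,\infty]$ (with $1/\infty=0$), if $\Gamma_2(u)(x)\ge k(x)\,\Gamma(u)(x)+\frac1N(Lu)^2(x)$ for all $u\in\mathcal A$, $x\in X$. For $L'$ the condition is formed with $\Gamma',\Gamma_2'$,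 defined by the same formulas with $L'$ in place of $L$. Conventions: $\frac1{N'-N}=0$ if $N'=\infty$; if $k'(x)=\pm\infty$, then $0\cdot(\pm\infty)=0$. *)

theory Defs
  imports "HOL-Analysis.Analysis"
begin

text \<open>
  Points of \<open>\<real>\<^sup>r\<close> are represented by sequences \<open>y :: nat \<Rightarrow> real\<close> of which only the coordinates
  \<open>y 1, \<dots>, y r\<close> matter, so that \<open>r\<close> can be quantified over inside a formula.  A real function on
  \<open>\<real>\<^sup>r\<close> is a function on sequences that depends on these coordinates only; for such a function,
  continuity in the product topology on \<open>nat \<Rightarrow> real\<close> is the usual continuity on \<open>\<real>\<^sup>r\<close>.
\<close>

definition pderiv_coord :: "nat \<Rightarrow> ((nat \<Rightarrow> real) \<Rightarrow> real) \<Rightarrow> (nat \<Rightarrow> real) \<Rightarrow> real" where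
  "pderiv_coord i \<psi> y = deriv (\<lambda>t. \<psi> (y(i := t))) (y i)"

text \<open>
  \<open>C\<^sup>\<infinity>\<close> on \<open>\<real>\<^sup>r\<close>: all iterated partial derivatives, in any order, exist and are continuous
  (the empty list of indices gives the function itself).
\<close>

definition smooth_fun :: "nat \<Rightarrow> ((nat \<Rightarrow> real) \<Rightarrow> real) \<Rightarrow> bool" where
  "smooth_fun r \<psi> \<longleftrightarrow>
     (\<forall>y z. (\<forall>i\<in>{1..r}. y i = z i) \<longrightarrow> \<psi> y = \<psi> z) \<and>
     (\<forall>is. set is \<subseteq> {1..r} \<longrightarrow>
        continuous_on UNIV (foldr pderiv_coord is \<psi>) \<and>
        (\<forall>i\<in>{1..r}. \<forall>y. (\<lambda>t. foldr pderiv_coord is \<psi> (y(i := t))) differentiable (at (y i))))"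

definition function_algebra :: "('a \<Rightarrow> real) set \<Rightarrow> bool" where
  "function_algebra A \<longleftrightarrow>
     (\<lambda>x. 0) \<in> A \<and>
     (\<forall>f\<in>A. \<forall>g\<in>A. (\<lambda>x. f x + g x) \<in> A) \<and>
     (\<forall>c. \<forall>f\<in>A. (\<lambda>x. c * f x) \<in> A) \<and>
     (\<forall>f\<in>A. \<forall>g\<in>A. (\<lambda>x. f x * g x) \<in> A)"

text \<open>
  Operators are total functions on \<open>'a \<Rightarrow> real\<close>; only their values on the algebra \<open>A\<close> are constrained.
\<close>

definition linear_operator_on ::
    "('a \<Rightarrow> real) set \<Rightarrow> (('a \<Rightarrow> real) \<Rightarrow> 'a \<Rightarrow> real) \<Rightarrow> bool" where
  "linear_operator_on A L \<longleftrightarrow>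
     (\<forall>f\<in>A. L f \<in> A) \<and>
     (\<forall>f\<in>A. \<forall>g\<in>A. L (\<lambda>x. f x + g x) = (\<lambda>x. L f x + L g x)) \<and>
     (\<forall>c. \<forall>f\<in>A. L (\<lambda>x. c * f x) = (\<lambda>x. c * L f x))"

definition Gam :: "(('a \<Rightarrow> real) \<Rightarrow> 'a \<Rightarrow> real) \<Rightarrow> ('a \<Rightarrow> real) \<Rightarrow> ('a \<Rightarrow> real) \<Rightarrow> 'a \<Rightarrow> real" where
  "Gam L f g x = (1/2) * (L (\<lambda>y. f y * g y) x - f x * L g x - g x * L f x)"

definition Gam2 :: "(('a \<Rightarrow> real) \<Rightarrow> 'a \<Rightarrow> real) \<Rightarrow> ('a \<Rightarrow> real) \<Rightarrow> ('a \<Rightarrow> real) \<Rightarrow> 'a \<Rightarrow> real" where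
  "Gam2 L f g x = (1/2) * (L (Gam L f g) x - Gam L f (L g) x - Gam L g (L f) x)"

definition Hess ::
    "(('a \<Rightarrow> real) \<Rightarrow> 'a \<Rightarrow> real) \<Rightarrow> ('a \<Rightarrow> real) \<Rightarrow> ('a \<Rightarrow> real) \<Rightarrow> ('a \<Rightarrow> real) \<Rightarrow> 'a \<Rightarrow> real" where
  "Hess L f g h x =
     (1/2) * (Gam L g (Gam L f h) x + Gam L h (Gam L f g) x - Gam L f (Gam L g h) x)"

definition diffusion_operator ::
    "('a \<Rightarrow> real) set \<Rightarrow> (('a \<Rightarrow> real) \<Rightarrow> 'a \<Rightarrow> real) \<Rightarrow> bool" where
  "diffusion_operator A L \<longleftrightarrow>
     function_algebra A \<and> linear_operator_on A L \<and>
     (\<forall>f\<in>A. \<forall>x. 0 \<le> Gam L f f x) \<and>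
     (\<forall>r F \<psi>. (\<forall>i\<in>{1..r}. F i \<in> A) \<and> smooth_fun r \<psi> \<and> \<psi> (\<lambda>_. 0) = 0 \<longrightarrow>
        (\<lambda>x. \<psi> (\<lambda>i. F i x)) \<in> A \<and>
        (\<forall>x. L (\<lambda>x. \<psi> (\<lambda>i. F i x)) x =
           (\<Sum>i=1..r. pderiv_coord i \<psi> (\<lambda>l. F l x) * L (F i) x) +
           (\<Sum>i=1..r. \<Sum>j=1..r.
              pderiv_coord i (pderiv_coord j \<psi>) (\<lambda>l. F l x) * Gam L (F i) (F j) x)))"

text \<open>
  The curvature bound may take the values \<open>\<plusminus>\<infinity>\<close>.  Arithmetic in \<^typ>\<open>ereal\<close> supplies the conventions
  \<open>0 * (\<plusminus>\<infinity>) = 0\<close> and \<open>1 / \<infinity> = 0\<close>; the second summand is always finite.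
\<close>

definition BE ::
    "('a \<Rightarrow> real) set \<Rightarrow> (('a \<Rightarrow> real) \<Rightarrow> 'a \<Rightarrow> real) \<Rightarrow> ('a \<Rightarrow> ereal) \<Rightarrow> ereal \<Rightarrow> bool" where
  "BE A L k N \<longleftrightarrow>
     (\<forall>u\<in>A. \<forall>x. ereal (Gam2 L u u x) \<ge>
        k x * ereal (Gam L u u x) + (1 / N) * ereal ((L u x)\<^sup>2))"

end

theory Submission
  imports Defs
begin

text \<open>
  Write \<open>\<Gamma>\<close>, \<open>\<Gamma>\<^sub>2\<close>, \<open>H\<close> for the forms of \<open>L\<close>, and \<open>L' = f\<^sup>2 L + V\<close> with the derivation
  \<open>V u = f \<cdot> a(u)\<close>, \<open>a(u) = \<Sum>\<^sub>i g\<^sub>i \<Gamma>(h\<^sub>i, u)\<close>.  The Leibniz rule alone gives \<open>\<Gamma>' = f\<^sup>2 \<Gamma>\<close> and a formula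
  for \<open>\<Gamma>\<^sub>2'(u)\<close> in terms of \<open>L\<close> (\<open>Gam2_transform\<close>).  Besides terms that already occur in \<open>k'\<close>, it
  contains \<open>f\<^sup>2\<close> times
    \<open>R = f\<^sup>2 \<Gamma>\<^sub>2(u) + 2 f \<Gamma>(f, \<Gamma>(u)) - 2 f L u \<Gamma>(f, u)\<close>,
  and everything comes down to bounding \<open>R\<close> from below.

  On a Riemannian manifold with \<open>L\<close> the Laplacian, \<open>f\<^sup>2 \<Gamma>\<^sub>2(u) + 2 f \<Gamma>(f, \<Gamma>(u))\<close> is, up to the Ricci term and
  terms in first derivatives, the squared norm of \<open>f \<cdot> Hess u + \<nabla>u \<otimes> \<nabla>f + \<nabla>f \<otimes> \<nabla>u\<close>.  At a point \<open>x\<close> with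
  \<open>f(x) \<noteq> 0\<close> this tensor is \<open>f(x)\<close> times the Hessian at \<open>x\<close> of the function
    \<open>v = u + f(x)\<^sup>-\<^sup>1 (u - u(x)) (f - f(x))\<close>,
  which has the same gradient as \<open>u\<close> at \<open>x\<close>.  So it is enough to apply the hypothesis
  \<open>BE(k, N)\<close> to \<open>v\<close> at the point \<open>x\<close> and to expand both sides by the Leibniz rule; this is
  \<open>conformal_inequality\<close>.  With \<open>c = \<Gamma>(f, u)\<close> it bounds \<open>R\<close> below by
    \<open>(f\<^sup>2 k - 2 \<Gamma>(f)) \<Gamma>(u) + (f L u - (N - 2) c)\<^sup>2 / N - (N - 2) c\<^sup>2\<close>.
  Since \<open>L' u = f (X + Y)\<close> for \<open>X = f L u - (N - 2) c\<close> and \<open>Y = (N - 2) c + a(u)\<close>, the elementary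
  inequality \<open>(X + Y)\<^sup>2 / N' \<le> X\<^sup>2 / N + Y\<^sup>2 / (N' - N)\<close> trades \<open>X\<^sup>2 / N\<close> for the dimension term of \<open>L'\<close>.  This
  proves the claim, for the single function \<open>u\<close>, with the bracket under the infimum evaluated at \<open>u\<close>
  (\<open>Gam2_drift_lower_bound\<close>).  Where \<open>f(x) = 0\<close>, both sides of that bound vanish.

  The infimum controls that bracket only where \<open>\<Gamma>(u)(x) > 0\<close>.  Where \<open>\<Gamma>(u)(x) = 0\<close> the bracket has to
  vanish.  Cauchy--Schwarz disposes of all its terms except \<open>\<Gamma>(h\<^sub>i, \<Gamma>(u))(x)\<close> in the Hessian; that one
  vanishes because applying \<open>BE(k, N)\<close> to \<open>u + t (u - u(x)) (h\<^sub>i - h\<^sub>i(x))\<close> gives a lower bound, for all real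
  \<open>t\<close>, on an affine function of \<open>t\<close> whose slope is this term, up to a factor (\<open>Gam_Gam_null\<close>).
\<close>

section \<open>Multilinear monomials are smooth\<close>

lemma pderiv_coord_monomial:
  assumes "finite S"
  shows "pderiv_coord i (\<lambda>y. c * (\<Prod>j\<in>S. y j)) =
         (\<lambda>y. (if i \<in> S then c else 0) * (\<Prod>j\<in>S - {i}. y j))"
    and "(\<lambda>t. c * (\<Prod>j\<in>S. (y(i := t)) j)) differentiable (at s)"
proof -
  have eq: "(\<lambda>t. c * (\<Prod>j\<in>S. (y(i := t)) j)) =
      (\<lambda>t. if i \<in> S then c * (t * (\<Prod>j\<in>S - {i}. y j)) else c * (\<Prod>j\<in>S - {i}. y j))" for y
  proof
    fix t
    have "(\<Prod>j\<in>S - {i}. (y(i := t)) j) = (\<Prod>j\<in>S - {i}. y j)"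
      by (rule prod.cong) auto
    then show "c * (\<Prod>j\<in>S. (y(i := t)) j) =
        (if i \<in> S then c * (t * (\<Prod>j\<in>S - {i}. y j)) else c * (\<Prod>j\<in>S - {i}. y j))"
      using assms by (cases "i \<in> S") (simp_all add: prod.remove)
  qed
  have "((\<lambda>t. c * (\<Prod>j\<in>S. (y(i := t)) j)) has_real_derivative
      (if i \<in> S then c else 0) * (\<Prod>j\<in>S - {i}. y j)) (at s)" for y s
    unfolding eq by (cases "i \<in> S") (auto intro!: derivative_eq_intros)
  then show "pderiv_coord i (\<lambda>y. c * (\<Prod>j\<in>S. y j)) =
         (\<lambda>y. (if i \<in> S then c else 0) * (\<Prod>j\<in>S - {i}. y j))"
    and "(\<lambda>t. c * (\<Prod>j\<in>S. (y(i := t)) j)) differentiable (at s)"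
    by (auto simp: pderiv_coord_def fun_eq_iff real_differentiable_def intro!: DERIV_imp_deriv)
qed

text \<open>
  The functions \<open>c \<cdot> (\<Prod>j\<in>T. y j)\<close>, with \<open>c = 0\<close> allowed, are closed under partial derivatives, so every
  iterated derivative of a monomial is again one of them.
\<close>

lemma smooth_fun_monomial:
  assumes "S \<subseteq> {1..r}"
  shows "smooth_fun r (\<lambda>y. \<Prod>j\<in>S. y j)"
proof -
  have fin: "finite S" using assms finite_subset by blast
  have ex: "\<exists>c T. finite T \<and> foldr pderiv_coord js (\<lambda>y. \<Prod>j\<in>S. y j) = (\<lambda>y. c * (\<Prod>j\<in>T. y j))"
    for js
  proof (induction js)
    case Nil
    show ?case using fin by (intro exI[of _ 1] exI[of _ S]) simp
  next
    case (Cons i js)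
    then obtain c T where T: "finite T" and
      eq: "foldr pderiv_coord js (\<lambda>y. \<Prod>j\<in>S. y j) = (\<lambda>y. c * (\<Prod>j\<in>T. y j))"
      by blast
    show ?case
      using T by (intro exI[of _ "if i \<in> T then c else 0"] exI[of _ "T - {i}"])
        (simp add: eq pderiv_coord_monomial(1))
  qed
  have "continuous_on UNIV (foldr pderiv_coord js (\<lambda>y. \<Prod>j\<in>S. y j)) \<and>
        (\<forall>i\<in>{1..r}. \<forall>y. (\<lambda>t. foldr pderiv_coord js (\<lambda>y. \<Prod>j\<in>S. y j) (y(i := t)))
           differentiable (at (y i)))" for js
  proof -
    obtain c T where T: "finite T" and
      eq: "foldr pderiv_coord js (\<lambda>y. \<Prod>j\<in>S. y j) = (\<lambda>y. c * (\<Prod>j\<in>T. y j))"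
      using ex by blast
    have "continuous_on UNIV (\<lambda>y::nat \<Rightarrow> real. c * (\<Prod>j\<in>T. y j))"
      by (intro continuous_intros continuous_on_product_coordinates)
    then show ?thesis
      unfolding eq using pderiv_coord_monomial(2)[OF T] by blast
  qed
  moreover have "(\<Prod>j\<in>S. y j) = (\<Prod>j\<in>S. z j)" if "\<forall>i\<in>{1..r}. y i = z i" for y z :: "nat \<Rightarrow> real"
    using assms that by (intro prod.cong) auto
  ultimately show ?thesis
    unfolding smooth_fun_def by blast
qed

section \<open>Calculus of a diffusion operator\<close>

lemma Gam_commute: "Gam L u v = Gam L v u"
  by (simp add: Gam_def fun_eq_iff mult.commute)

lemma L_mult: "L (\<lambda>y. u y * v y) x = u x * L v x + v x * L u x + 2 * Gam L u v x"
  by (simp add: Gam_def field_simps)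

lemma Gam2_self: "Gam2 L u u x = (1/2) * L (Gam L u u) x - Gam L u (L u) x"
  by (simp add: Gam2_def field_simps)

lemma affine_nonneg_slope_zero:
  fixes a b :: real
  assumes "\<And>t. 0 \<le> a + t * b"
  shows "b = 0"
proof (rule ccontr)
  assume "b \<noteq> 0"
  then show False using assms[of "- (a + 1) / b"] by simp
qed

locale diffusion =
  fixes A :: "('a \<Rightarrow> real) set" and L :: "('a \<Rightarrow> real) \<Rightarrow> 'a \<Rightarrow> real"
  assumes diffusion: "diffusion_operator A L"
begin

lemma zero_mem: "(\<lambda>x. 0) \<in> A"
  and add_mem: "u \<in> A \<Longrightarrow> v \<in> A \<Longrightarrow> (\<lambda>x. u x + v x) \<in> A"
  and scale_mem: "u \<in> A \<Longrightarrow> (\<lambda>x. c * u x) \<in> A"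
  and mult_mem: "u \<in> A \<Longrightarrow> v \<in> A \<Longrightarrow> (\<lambda>x. u x * v x) \<in> A"
  and L_mem: "u \<in> A \<Longrightarrow> L u \<in> A"
  and L_add: "u \<in> A \<Longrightarrow> v \<in> A \<Longrightarrow> L (\<lambda>x. u x + v x) = (\<lambda>x. L u x + L v x)"
  and L_scale: "u \<in> A \<Longrightarrow> L (\<lambda>x. c * u x) = (\<lambda>x. c * L u x)"
  and Gam_nonneg: "u \<in> A \<Longrightarrow> 0 \<le> Gam L u u x"
  using diffusion
  by (auto simp: diffusion_operator_def function_algebra_def linear_operator_on_def)

lemma diff_mem: "u \<in> A \<Longrightarrow> v \<in> A \<Longrightarrow> (\<lambda>x. u x - v x) \<in> A"
  using add_mem[of u "\<lambda>x. (-1) * v x"] scale_mem[of v "-1"] by simp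

lemma L_diff: "u \<in> A \<Longrightarrow> v \<in> A \<Longrightarrow> L (\<lambda>x. u x - v x) = (\<lambda>x. L u x - L v x)"
  using L_add[of u "\<lambda>x. (-1) * v x"] scale_mem[of v "-1"] L_scale[of v "-1"] by simp

lemma sum_mem: "(\<And>i. i \<in> I \<Longrightarrow> F i \<in> A) \<Longrightarrow> (\<lambda>x. \<Sum>i\<in>I. F i x) \<in> A"
  by (induction I rule: infinite_finite_induct) (auto intro: zero_mem add_mem)

lemma Gam_mem: "u \<in> A \<Longrightarrow> v \<in> A \<Longrightarrow> Gam L u v \<in> A"
  unfolding Gam_def by (intro scale_mem diff_mem L_mem mult_mem)

lemma Gam_add_right:
  assumes "u \<in> A" "v \<in> A" "w \<in> A"
  shows "Gam L w (\<lambda>x. u x + v x) x = Gam L w u x + Gam L w v x"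
  using assms by (simp add: Gam_def L_add mult_mem distrib_left) (simp add: field_simps)

lemma Gam_scale_right:
  assumes "u \<in> A" "w \<in> A"
  shows "Gam L w (\<lambda>x. c * u x) x = c * Gam L w u x"
proof -
  have "(\<lambda>y. w y * (c * u y)) = (\<lambda>y. c * (w y * u y))" by (simp add: fun_eq_iff)
  then show ?thesis
    using assms by (simp add: Gam_def L_scale mult_mem) (simp add: field_simps)
qed

lemma Gam_zero_right:
  assumes "w \<in> A"
  shows "Gam L w (\<lambda>x. 0) x = 0"
  using Gam_scale_right[OF assms assms, of 0 x] by simp

lemma Gam_sum_right:
  assumes "\<And>i. i \<in> I \<Longrightarrow> F i \<in> A" "w \<in> A"
  shows "Gam L w (\<lambda>x. \<Sum>i\<in>I. F i x) x = (\<Sum>i\<in>I. Gam L w (F i) x)"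
  using assms
  by (induction I rule: infinite_finite_induct) (simp_all add: Gam_zero_right Gam_add_right sum_mem)

text \<open>
  The diffusion property for \<open>\<psi>(y) = y\<^sub>1 y\<^sub>2 y\<^sub>3\<close>.  This single choice of \<open>\<psi>\<close> carries the whole calculus:
  it is equivalent to the Leibniz rule for \<open>\<Gamma>\<close> proved next.
\<close>

lemma L_mult3:
  assumes "u \<in> A" "v \<in> A" "w \<in> A"
  shows "L (\<lambda>y. u y * v y * w y) x =
    v x * w x * L u x + u x * w x * L v x + u x * v x * L w x +
    2 * (w x * Gam L u v x + v x * Gam L u w x + u x * Gam L v w x)"
proof -
  define F :: "nat \<Rightarrow> 'a \<Rightarrow> real" where "F i = (if i = 1 then u else if i = 2 then v else w)" for i
  define \<psi> :: "(nat \<Rightarrow> real) \<Rightarrow> real" where "\<psi> y = (\<Prod>j\<in>{1..3}. y j)" for y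
  have S: "{1..3::nat} = {1,2,3}" by auto
  have sm: "smooth_fun 3 \<psi>"
    unfolding \<psi>_def by (rule smooth_fun_monomial) simp
  have FA: "\<forall>i\<in>{1..3}. F i \<in> A" using assms by (simp add: F_def)
  have z: "\<psi> (\<lambda>_. 0) = 0" by (simp add: \<psi>_def)
  have d1: "pderiv_coord i \<psi> = (\<lambda>y. (if i \<in> {1..3} then 1 else 0) * (\<Prod>j\<in>{1..3} - {i}. y j))" for i
    using pderiv_coord_monomial(1)[of "{1..3}" i 1] unfolding \<psi>_def by simp
  have d2: "pderiv_coord i (pderiv_coord j \<psi>) =
    (\<lambda>y. (if i \<in> {1..3} - {j} then (if j \<in> {1..3} then 1 else 0) else 0)
           * (\<Prod>l\<in>{1..3} - {j} - {i}. y l))" for i j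
    unfolding d1 by (rule pderiv_coord_monomial(1)) simp
  have "L (\<lambda>x. \<psi> (\<lambda>i. F i x)) x =
      (\<Sum>i=1..3. pderiv_coord i \<psi> (\<lambda>l. F l x) * L (F i) x) +
      (\<Sum>i=1..3. \<Sum>j=1..3. pderiv_coord i (pderiv_coord j \<psi>) (\<lambda>l. F l x) * Gam L (F i) (F j) x)"
    using diffusion FA sm z unfolding diffusion_operator_def by blast
  moreover have "(\<lambda>x. \<psi> (\<lambda>i. F i x)) = (\<lambda>y. u y * v y * w y)"
    unfolding \<psi>_def S by (simp add: F_def fun_eq_iff)
  ultimately show ?thesis
    unfolding d2 unfolding d1 S
    by (simp add: insert_Diff_if F_def Gam_commute[of L v u] Gam_commute[of L w u] Gam_commute[of L w v]
        algebra_simps)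
qed

lemma Gam_mult_right:
  assumes "u \<in> A" "v \<in> A" "w \<in> A"
  shows "Gam L w (\<lambda>y. u y * v y) x = u x * Gam L w v x + v x * Gam L w u x"
proof -
  have "2 * Gam L w (\<lambda>y. u y * v y) x =
      L (\<lambda>y. w y * u y * v y) x - w x * L (\<lambda>y. u y * v y) x - u x * v x * L w x"
    by (simp add: Gam_def mult.assoc)
  also have "\<dots> = 2 * (u x * Gam L w v x + v x * Gam L w u x)"
    unfolding L_mult3[OF assms(3,1,2)] L_mult[of L u v] by (simp add: algebra_simps)
  finally show ?thesis by simp
qed

text \<open>
  The algebra need not contain the constants, so \<open>u - c\<close> is in general not an element of it, but
  \<open>(u - c) v\<close> always is.  The rules below are the product rules with \<open>L 1 = 0\<close> and \<open>\<Gamma>(1, w) = 0\<close>.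
\<close>

lemma L_shift_mult:
  assumes "u \<in> A" "v \<in> A"
  shows "L (\<lambda>y. (u y - c) * v y) x = (u x - c) * L v x + v x * L u x + 2 * Gam L u v x"
  using assms by (simp add: left_diff_distrib L_diff L_scale L_mult mult_mem scale_mem)

lemma Gam_shift_mult_right:
  assumes "u \<in> A" "v \<in> A" "w \<in> A"
  shows "Gam L w (\<lambda>y. (u y - c) * v y) x = (u x - c) * Gam L w v x + v x * Gam L w u x"
proof -
  have "(\<lambda>y. (u y - c) * v y) = (\<lambda>y. u y * v y + (- c) * v y)"
    by (simp add: fun_eq_iff algebra_simps)
  then show ?thesis
    using assms by (simp only: Gam_add_right Gam_scale_right Gam_mult_right mult_mem scale_mem)
      (simp add: algebra_simps)
qed

lemma shift_mult_mem:
  assumes "u \<in> A" "v \<in> A"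
  shows "(\<lambda>y. (u y - c) * v y) \<in> A"
  using diff_mem[OF mult_mem[OF assms] scale_mem[OF assms(2), of c]] by (simp add: left_diff_distrib)

lemma Gam_add_scale_self:
  assumes "u \<in> A" "w \<in> A"
  shows "Gam L (\<lambda>y. u y + t * w y) (\<lambda>y. u y + t * w y) x =
    Gam L u u x + 2 * t * Gam L u w x + t\<^sup>2 * Gam L w w x"
proof -
  let ?v = "\<lambda>y. u y + t * w y"
  have v: "?v \<in> A" using assms by (intro add_mem scale_mem)
  have r: "Gam L q ?v x = Gam L q u x + t * Gam L q w x" if "q \<in> A" for q
    using assms that by (simp add: Gam_add_right Gam_scale_right scale_mem)
  show ?thesis
    unfolding r[OF v] Gam_commute[of L ?v u] Gam_commute[of L ?v w] r[OF assms(1)] r[OF assms(2)]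
      Gam_commute[of L w u]
    by (simp add: algebra_simps power2_eq_square)
qed

text \<open>
  The equality case of Cauchy--Schwarz: \<open>\<Gamma>(v + t u)(x)\<close> is nonnegative and affine in \<open>t\<close>.
\<close>

lemma Gam_null:
  assumes "u \<in> A" "v \<in> A" "Gam L u u x = 0"
  shows "Gam L u v x = 0"
proof -
  have "0 \<le> Gam L v v x + t * (2 * Gam L v u x)" for t
    using Gam_nonneg[OF add_mem[OF assms(2) scale_mem[OF assms(1)]], of t x]
      Gam_add_scale_self[OF assms(2,1), of t x] assms(3) by (simp add: mult.assoc mult.left_commute)
  from affine_nonneg_slope_zero[OF this] show ?thesis by (simp add: Gam_commute)
qed

section \<open>Second order perturbations at a point\<close>

lemma Gam2_add_scale_self:
  assumes u: "u \<in> A" and w: "w \<in> A"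
  shows "Gam2 L (\<lambda>y. u y + t * w y) (\<lambda>y. u y + t * w y) x =
    Gam2 L u u x + 2 * t * Gam2 L u w x + t\<^sup>2 * Gam2 L w w x"
proof -
  let ?v = "\<lambda>y. u y + t * w y"
  have v: "?v \<in> A" using assms by (intro add_mem scale_mem)
  have Lv: "L ?v = (\<lambda>y. L u y + t * L w y)" using assms by (simp add: L_add L_scale scale_mem)
  have G: "Gam L ?v ?v = (\<lambda>y. (Gam L u u y + (2 * t) * Gam L u w y) + t\<^sup>2 * Gam L w w y)"
    using Gam_add_scale_self[OF assms] by (simp add: fun_eq_iff)
  have LG: "L (Gam L ?v ?v) x = L (Gam L u u) x + 2 * t * L (Gam L u w) x + t\<^sup>2 * L (Gam L w w) x"
    unfolding G using assms by (simp add: L_add L_scale add_mem scale_mem Gam_mem)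
  have r: "Gam L ?v q x = Gam L u q x + t * Gam L w q x" if "q \<in> A" for q
    using assms that by (simp add: Gam_add_right Gam_scale_right scale_mem Gam_commute[of L _ q])
  have GL: "Gam L ?v (L ?v) x =
      Gam L u (L u) x + t * (Gam L u (L w) x + Gam L w (L u) x) + t\<^sup>2 * Gam L w (L w) x"
    unfolding Lv using assms
    by (simp add: r add_mem scale_mem L_mem Gam_add_right Gam_scale_right)
      (simp add: algebra_simps power2_eq_square)
  show ?thesis
    unfolding Gam2_self LG GL by (simp add: Gam2_def algebra_simps)
qed

text \<open>
  This is \<open>(u - u(x)) (q - q(x))\<close> without its constant term \<open>u(x) q(x)\<close>, which might not belong to the
  algebra and which \<open>L\<close> and \<open>\<Gamma>\<close> do not see.  At \<open>x\<close> its gradient vanishes and its Hessian is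
  \<open>\<nabla>u \<otimes> \<nabla>q + \<nabla>q \<otimes> \<nabla>u\<close>: adding a multiple of it changes \<open>u\<close> to second order only.
\<close>

definition centred_product :: "('a \<Rightarrow> real) \<Rightarrow> ('a \<Rightarrow> real) \<Rightarrow> 'a \<Rightarrow> 'a \<Rightarrow> real" where
  "centred_product u q x = (\<lambda>y. (u y - u x) * q y + (- q x) * u y)"

lemma centred_product_calculus:
  assumes u: "u \<in> A" and q: "q \<in> A"
  shows centred_product_mem: "centred_product u q x \<in> A"
    and L_centred_product: "L (centred_product u q x) = (\<lambda>y. ((u y - u x) * L q y + (q y - q x) * L u y) + 2 * Gam L u q y)"
    and Gam_centred_product: "p \<in> A \<Longrightarrow> Gam L p (centred_product u q x) =
      (\<lambda>y. (u y - u x) * Gam L p q y + (q y - q x) * Gam L p u y)"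
proof -
  note m = shift_mult_mem[OF u q] scale_mem[OF u]
  show "centred_product u q x \<in> A"
    unfolding centred_product_def by (rule add_mem[OF m])
  show "L (centred_product u q x) = (\<lambda>y. ((u y - u x) * L q y + (q y - q x) * L u y) + 2 * Gam L u q y)"
    unfolding centred_product_def L_add[OF m] L_scale[OF u] L_shift_mult[OF u q]
    by (simp add: fun_eq_iff algebra_simps)
  show "Gam L p (centred_product u q x) = (\<lambda>y. (u y - u x) * Gam L p q y + (q y - q x) * Gam L p u y)"
    if "p \<in> A"
    unfolding centred_product_def fun_eq_iff Gam_add_right[OF m that] Gam_scale_right[OF u that]
      Gam_shift_mult_right[OF u q that]
    by (simp add: algebra_simps)
qed

text \<open>
  With \<open>w\<close> the centred product, these are the values at \<open>x\<close> of the pairings of Hessians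
  \<open>\<langle>Hess u, Hess w\<rangle>\<close> and \<open>\<bar>Hess w\<bar>\<^sup>2\<close>; curvature does not enter because the gradient of \<open>w\<close> vanishes there.
\<close>

lemma Gam2_centred_product:
  assumes u: "u \<in> A" and q: "q \<in> A"
  shows Gam2_centred_product_mixed: "Gam2 L u (centred_product u q x) x = Gam L q (Gam L u u) x"
    and Gam2_centred_product_self: "Gam2 L (centred_product u q x) (centred_product u q x) x =
      2 * (Gam L u u x * Gam L q q x + (Gam L u q x)\<^sup>2)"
proof -
  let ?w = "centred_product u q x"
  note w = centred_product_mem[OF u q, of x]
  have G0: "Gam L p ?w x = 0" if "p \<in> A" for p
    using Gam_centred_product[OF u q that] by simp
  have LG: "L (Gam L p ?w) x = Gam L p q x * L u x + 2 * Gam L u (Gam L p q) x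
      + Gam L p u x * L q x + 2 * Gam L q (Gam L p u) x" if "p \<in> A" for p
    using that u q
    by (simp add: Gam_centred_product L_add shift_mult_mem Gam_mem L_shift_mult)
  have GG: "Gam L s (Gam L p ?w) x = Gam L p q x * Gam L s u x + Gam L p u x * Gam L s q x"
    if "p \<in> A" "s \<in> A" for p s
    using that u q by (simp add: Gam_centred_product Gam_add_right shift_mult_mem Gam_mem Gam_shift_mult_right)
  have "Gam L u (L ?w) x = L q x * Gam L u u x + L u x * Gam L u q x + 2 * Gam L u (Gam L u q) x"
    using u q by (simp add: L_centred_product Gam_add_right Gam_scale_right add_mem scale_mem shift_mult_mem
        L_mem Gam_mem Gam_shift_mult_right)
  then show "Gam2 L u ?w x = Gam L q (Gam L u u) x"
    using G0[OF L_mem[OF u]] by (simp add: Gam2_def LG[OF u] Gam_commute[of L ?w])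
  show "Gam2 L ?w ?w x = 2 * (Gam L u u x * Gam L q q x + (Gam L u q x)\<^sup>2)"
    unfolding Gam2_self Gam_commute[of L ?w "L ?w"] G0[OF L_mem[OF w]] LG[OF w]
      Gam_commute[of L ?w q] Gam_commute[of L ?w u] G0[OF q] G0[OF u] GG[OF q u] GG[OF u q]
    by (simp add: Gam_commute[of L q u] power2_eq_square algebra_simps)
qed

section \<open>Change of the operator\<close>

lemma Gam_transform:
  assumes L': "\<And>u. u \<in> A \<Longrightarrow> L' u = (\<lambda>x. (f x)\<^sup>2 * L u x + V u x)"
    and V: "\<And>u v x. u \<in> A \<Longrightarrow> v \<in> A \<Longrightarrow> V (\<lambda>y. u y * v y) x = u x * V v x + v x * V u x"
    and "u \<in> A" "v \<in> A"
  shows "Gam L' u v = (\<lambda>x. (f x)\<^sup>2 * Gam L u v x)"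
  using assms(3,4)
  by (simp add: fun_eq_iff Gam_def[of L'] L' V mult_mem L_mult[of L]) (simp add: field_simps)

text \<open>
  Here \<open>V\<close> is any derivation of the algebra; its second order contribution is left in the commutator form
  \<open>V \<Gamma>(u) / 2 - \<Gamma>(u, V u)\<close>.
\<close>

lemma Gam2_transform:
  assumes L': "\<And>u. u \<in> A \<Longrightarrow> L' u = (\<lambda>x. (f x)\<^sup>2 * L u x + V u x)"
    and V: "\<And>u v x. u \<in> A \<Longrightarrow> v \<in> A \<Longrightarrow> V (\<lambda>y. u y * v y) x = u x * V v x + v x * V u x"
    and VA: "\<And>u. u \<in> A \<Longrightarrow> V u \<in> A"
    and f: "f \<in> A" and u: "u \<in> A"
  shows "Gam2 L' u u x = (f x)^4 * Gam2 L u u x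
    + (f x)\<^sup>2 * Gam L u u x * ((1/2) * L (\<lambda>y. (f y)\<^sup>2) x)
    + 2 * (f x)^3 * Gam L f (Gam L u u) x - 2 * (f x)^3 * L u x * Gam L f u x
    + f x * V f x * Gam L u u x
    + (f x)\<^sup>2 * ((1/2) * V (Gam L u u) x - Gam L u (V u) x)"
proof -
  have ff: "(\<lambda>y. (f y)\<^sup>2) = (\<lambda>y. f y * f y)" by (simp add: power2_eq_square)
  have f2: "(\<lambda>y. (f y)\<^sup>2) \<in> A" unfolding ff by (rule mult_mem[OF f f])
  note Gu = Gam_mem[OF u u] and Lu = L_mem[OF u]
  note m = mult_mem[OF f2 Gu]
  have Gf2: "Gam L w (\<lambda>y. (f y)\<^sup>2) x = 2 * f x * Gam L w f x" if "w \<in> A" for w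
    unfolding ff using Gam_mult_right[OF f f that] by simp
  have Vf2: "V (\<lambda>y. (f y)\<^sup>2) x = 2 * f x * V f x"
    unfolding ff using V[OF f f] by simp
  have L'u: "L' u \<in> A" unfolding L'[OF u] by (intro add_mem mult_mem[OF f2] L_mem VA u)
  have G': "Gam L' u v = (\<lambda>x. (f x)\<^sup>2 * Gam L u v x)" if "v \<in> A" for v
    by (rule Gam_transform[where V = V]) (fact L' V u that)+
  have 1: "L' (Gam L' u u) x = (f x)\<^sup>2 * ((f x)\<^sup>2 * L (Gam L u u) x + Gam L u u x * L (\<lambda>y. (f y)\<^sup>2) x
      + 4 * f x * Gam L f (Gam L u u) x) + (f x)\<^sup>2 * V (Gam L u u) x + Gam L u u x * (2 * f x * V f x)"
    unfolding G'[OF u] L'[OF m] V[OF f2 Gu] L_mult[of L] Vf2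
      Gam_commute[of L "\<lambda>y. (f y)\<^sup>2"] Gf2[OF Gu] Gam_commute[of L _ f]
    by (simp add: algebra_simps)
  have 2: "Gam L' u (L' u) x = (f x)\<^sup>2 *
      ((f x)\<^sup>2 * Gam L u (L u) x + 2 * f x * L u x * Gam L f u x + Gam L u (V u) x)"
    unfolding G'[OF L'u] unfolding L'[OF u]
      Gam_add_right[OF mult_mem[OF f2 Lu] VA[OF u] u] Gam_mult_right[OF f2 Lu u] Gf2[OF u]
      Gam_commute[of L u f]
    by (simp add: algebra_simps)
  show ?thesis
    unfolding Gam2_self 1 2 by (simp add: algebra_simps power4_eq_xxxx power3_eq_cube power2_eq_square)
qed

section \<open>The curvature-dimension inequality\<close>

lemma BE_real:
  assumes "BE A L (\<lambda>x. ereal (k x)) (ereal N)" "N > 0" "u \<in> A"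
  shows "k x * Gam L u u x + (L u x)\<^sup>2 / N \<le> Gam2 L u u x"
proof -
  have "ereal (k x) * ereal (Gam L u u x) + 1 / ereal N * ereal ((L u x)\<^sup>2) \<le> ereal (Gam2 L u u x)"
    using assms(1,3) unfolding BE_def by blast
  then show ?thesis using assms(2) by (simp add: divide_ereal_def divide_inverse mult.commute)
qed

text \<open>
  The hypothesis applied at \<open>x\<close> to \<open>u + t w\<close>, with \<open>w\<close> the centred product of \<open>u\<close> and \<open>q\<close> at \<open>x\<close>.
\<close>

lemma centred_product_inequality:
  assumes BE: "BE A L (\<lambda>x. ereal (k x)) (ereal N)" and N: "N > 0"
    and u: "u \<in> A" and q: "q \<in> A"
  shows "k x * Gam L u u x + (L u x + 2 * t * Gam L u q x)\<^sup>2 / N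
    \<le> Gam2 L u u x + 2 * t * Gam L q (Gam L u u) x
      + 2 * t\<^sup>2 * (Gam L u u x * Gam L q q x + (Gam L u q x)\<^sup>2)"
proof -
  let ?w = "centred_product u q x"
  note w = centred_product_mem[OF u q, of x]
  have "(\<lambda>y. u y + t * ?w y) \<in> A" using u w by (intro add_mem scale_mem)
  note BE_real[OF BE N this, of x]
  moreover have "L (\<lambda>y. u y + t * ?w y) x = L u x + 2 * t * Gam L u q x"
    using u w by (simp add: L_add L_scale scale_mem L_centred_product[OF u q])
  moreover have "Gam L ?w ?w x = 0" "Gam L u ?w x = 0"
    using Gam_centred_product[OF u q w] Gam_centred_product[OF u q u] by simp_all
  ultimately show ?thesis
    by (simp add: Gam2_add_scale_self[OF u w] Gam_add_scale_self[OF u w] Gam2_centred_product[OF u q]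
        algebra_simps)
qed

text \<open>
  \<open>\<Gamma>(u)\<close> attains its minimum \<open>0\<close> at \<open>x\<close>, but on a bare set \<open>x\<close> may play the part of a boundary point, so
  this alone does not make its derivatives vanish there.  The curvature condition does: when \<open>\<Gamma>(u)(x) = 0\<close> the inequality
  above is affine in \<open>t\<close>.
\<close>

lemma Gam_Gam_null:
  assumes BE: "BE A L (\<lambda>x. ereal (k x)) (ereal N)" and N: "N > 0"
    and u: "u \<in> A" and q: "q \<in> A" and null: "Gam L u u x = 0"
  shows "Gam L q (Gam L u u) x = 0"
proof -
  have "0 \<le> (Gam2 L u u x - (L u x)\<^sup>2 / N) + t * (2 * Gam L q (Gam L u u) x)" for t
    using centred_product_inequality[OF BE N u q, of x t] null Gam_null[OF u q null] by simp
  from affine_nonneg_slope_zero[OF this] show ?thesis by simp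
qed

text \<open>
  The previous inequality with \<open>q = f\<close> and \<open>t = 1 / f(x)\<close>, multiplied by \<open>f(x)\<^sup>2\<close>.  Moving
  \<open>2 \<Gamma>(u) \<Gamma>(f) + 2 c\<^sup>2\<close> to the left, subtracting \<open>2 f L u c\<close> and completing the square in \<open>f L u\<close> produces the coefficients \<open>N - 2\<close>.
\<close>

lemma conformal_inequality:
  assumes BE: "BE A L (\<lambda>x. ereal (k x)) (ereal N)" and N: "N > 0"
    and u: "u \<in> A" and f: "f \<in> A" and fx: "f x \<noteq> 0"
  defines "c \<equiv> Gam L f u x"
  shows "((f x)\<^sup>2 * k x - 2 * Gam L f f x) * Gam L u u x
      + (f x * L u x - (N - 2) * c)\<^sup>2 / N - (N - 2) * c\<^sup>2
    \<le> (f x)\<^sup>2 * Gam2 L u u x + 2 * f x * Gam L f (Gam L u u) x - 2 * f x * L u x * c"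
proof -
  have "(f x)\<^sup>2 * (k x * Gam L u u x + (L u x + 2 * (1 / f x) * c)\<^sup>2 / N)
      \<le> (f x)\<^sup>2 * (Gam2 L u u x + 2 * (1 / f x) * Gam L f (Gam L u u) x
          + 2 * (1 / f x)\<^sup>2 * (Gam L u u x * Gam L f f x + c\<^sup>2))"
    unfolding c_def Gam_commute[of L f u]
    by (intro mult_left_mono centred_product_inequality[OF BE N u f]) simp
  moreover have "(f x)\<^sup>2 * (L u x + 2 * (1 / f x) * c)\<^sup>2 = (f x * L u x + 2 * c)\<^sup>2"
    using fx by (simp add: field_simps flip: power_mult_distrib)
  moreover have "(f x)\<^sup>2 * (2 * (1 / f x) * Gam L f (Gam L u u) x) = 2 * f x * Gam L f (Gam L u u) x"
    "(f x)\<^sup>2 * (2 * (1 / f x)\<^sup>2 * (Gam L u u x * Gam L f f x + c\<^sup>2))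
      = 2 * (Gam L u u x * Gam L f f x + c\<^sup>2)"
    using fx by (simp_all add: power2_eq_square)
  ultimately have "(f x)\<^sup>2 * k x * Gam L u u x + (f x * L u x + 2 * c)\<^sup>2 / N
      \<le> (f x)\<^sup>2 * Gam2 L u u x + 2 * f x * Gam L f (Gam L u u) x
          + 2 * (Gam L u u x * Gam L f f x + c\<^sup>2)"
    by (simp only: distrib_left times_divide_eq_right mult.assoc)
  moreover have "(f x * L u x - (N - 2) * c)\<^sup>2 / N - (N - 2) * c\<^sup>2
      = (f x * L u x + 2 * c)\<^sup>2 / N - 2 * c\<^sup>2 - 2 * f x * L u x * c"
    using N by (simp add: field_simps power2_eq_square)
  ultimately show ?thesis by (simp add: algebra_simps)
qed

definition drift ::
    "'i set \<Rightarrow> ('a \<Rightarrow> real) \<Rightarrow> ('i \<Rightarrow> 'a \<Rightarrow> real) \<Rightarrow> ('i \<Rightarrow> 'a \<Rightarrow> real) \<Rightarrow> ('a \<Rightarrow> real) \<Rightarrow> 'a \<Rightarrow> real" where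
  "drift I f g h u = (\<lambda>x. f x * (\<Sum>i\<in>I. g i x * Gam L (h i) u x))"

lemma drift_derivation:
  assumes f: "f \<in> A" and g: "\<And>i. i \<in> I \<Longrightarrow> g i \<in> A" and h: "\<And>i. i \<in> I \<Longrightarrow> h i \<in> A"
  shows drift_mem: "u \<in> A \<Longrightarrow> drift I f g h u \<in> A"
    and drift_mult: "u \<in> A \<Longrightarrow> v \<in> A \<Longrightarrow>
      drift I f g h (\<lambda>y. u y * v y) x = u x * drift I f g h v x + v x * drift I f g h u x"
proof -
  show "drift I f g h u \<in> A" if "u \<in> A"
    unfolding drift_def using assms that by (intro mult_mem sum_mem Gam_mem) auto
  show "drift I f g h (\<lambda>y. u y * v y) x = u x * drift I f g h v x + v x * drift I f g h u x"
    if "u \<in> A" "v \<in> A"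
    using that h
    by (simp add: drift_def Gam_mult_right sum_distrib_left sum.distrib algebra_simps)
qed

text \<open>
  Termwise, \<open>H\<^bsub>h\<^esub>(u, u) = \<Gamma>(u, \<Gamma>(h, u)) - \<Gamma>(h, \<Gamma>(u)) / 2\<close>; the remaining sum comes from differentiating
  the coefficients \<open>f g\<^sub>i\<close>.
\<close>

lemma drift_second_order:
  assumes f: "f \<in> A" and g: "\<And>i. i \<in> I \<Longrightarrow> g i \<in> A" and h: "\<And>i. i \<in> I \<Longrightarrow> h i \<in> A"
    and u: "u \<in> A"
  shows "(1/2) * drift I f g h (Gam L u u) x - Gam L u (drift I f g h u) x =
    - (\<Sum>i\<in>I. f x * g i x * Hess L (h i) u u x)
    - (\<Sum>i\<in>I. Gam L (\<lambda>y. f y * g i y) u x * Gam L (h i) u x)"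
proof -
  have fg: "(\<lambda>y. f y * g i y) \<in> A" if "i \<in> I" for i
    using f g[OF that] by (rule mult_mem)
  have Ghu: "Gam L (h i) u \<in> A" if "i \<in> I" for i
    using h[OF that] u by (rule Gam_mem)
  have d: "drift I f g h u = (\<lambda>y. \<Sum>i\<in>I. (f y * g i y) * Gam L (h i) u y)"
    by (simp add: drift_def sum_distrib_left mult.assoc)
  have "Gam L u (drift I f g h u) x = (\<Sum>i\<in>I. f x * g i x * Gam L u (Gam L (h i) u) x
      + Gam L (h i) u x * Gam L u (\<lambda>y. f y * g i y) x)"
    unfolding d using fg Ghu u
    by (subst Gam_sum_right) (auto intro!: mult_mem sum.cong f g simp: Gam_mult_right)
  moreover have "(1/2) * drift I f g h (Gam L u u) x
      = (\<Sum>i\<in>I. (1/2) * (f x * g i x * Gam L (h i) (Gam L u u) x))"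
    by (simp add: drift_def sum_distrib_left mult.assoc)
  ultimately show ?thesis
    by (simp only: flip: sum_subtractf sum_negf)
      (rule sum.cong, simp_all add: Hess_def Gam_commute[of L u "\<lambda>y. f y * g _ y"] algebra_simps)
qed

text \<open>
  The numbers \<open>e\<close> and \<open>d\<close> stand for \<open>1 / N'\<close> and \<open>1 / (N' - N)\<close>, both \<open>0\<close> when
  \<open>N' = \<infinity>\<close>; stated with them, one real inequality treats finite and infinite \<open>N'\<close> alike.
\<close>

lemma Gam2_drift_lower_bound:
  assumes L': "\<And>u. u \<in> A \<Longrightarrow> L' u = (\<lambda>x. (f x)\<^sup>2 * L u x + drift I f g h u x)"
    and f: "f \<in> A" and g: "\<And>i. i \<in> I \<Longrightarrow> g i \<in> A" and h: "\<And>i. i \<in> I \<Longrightarrow> h i \<in> A"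
    and BE: "BE A L (\<lambda>x. ereal (k x)) (ereal N)" and N: "N > 0" and u: "u \<in> A"
    and weights: "\<And>X Y. e * (X + Y)\<^sup>2 \<le> X\<^sup>2 / N + d * Y\<^sup>2"
  shows "(f x)\<^sup>2 * (((f x)\<^sup>2 * k x + (1/2) * L (\<lambda>y. (f y)\<^sup>2) x - 2 * Gam L f f x
            + (\<Sum>i\<in>I. g i x * Gam L (h i) f x)) * Gam L u u x
          + (- d * ((N - 2) * Gam L f u x + (\<Sum>i\<in>I. g i x * Gam L (h i) u x))\<^sup>2
             - (N - 2) * (Gam L f u x)\<^sup>2
             - (\<Sum>i\<in>I. f x * g i x * Hess L (h i) u u x)
             - (\<Sum>i\<in>I. Gam L (\<lambda>y. f y * g i y) u x * Gam L (h i) u x)))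
        + e * (L' u x)\<^sup>2 \<le> Gam2 L' u u x"
proof -
  define a where "a = (\<Sum>i\<in>I. g i x * Gam L (h i) u x)"
  define b where "b = (\<Sum>i\<in>I. g i x * Gam L (h i) f x)"
  define c where "c = Gam L f u x"
  define D where "D = - (\<Sum>i\<in>I. f x * g i x * Hess L (h i) u u x)
    - (\<Sum>i\<in>I. Gam L (\<lambda>y. f y * g i y) u x * Gam L (h i) u x)"
  define F where "F = L (\<lambda>y. (f y)\<^sup>2) x"
  have V: "drift I f g h (\<lambda>y. v y * w y) x = v x * drift I f g h w x + w x * drift I f g h v x"
    if "v \<in> A" "w \<in> A" for v w x
    by (rule drift_mult) (fact f g h that)+
  have VA: "drift I f g h v \<in> A" if "v \<in> A" for v
    by (rule drift_mem) (fact f g h that)+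
  have Gam2': "Gam2 L' u u x = (f x)^4 * Gam2 L u u x
      + (f x)\<^sup>2 * Gam L u u x * ((1/2) * L (\<lambda>y. (f y)\<^sup>2) x)
      + 2 * (f x)^3 * Gam L f (Gam L u u) x - 2 * (f x)^3 * L u x * Gam L f u x
      + f x * drift I f g h f x * Gam L u u x
      + (f x)\<^sup>2 * ((1/2) * drift I f g h (Gam L u u) x - Gam L u (drift I f g h u) x)"
    by (rule Gam2_transform) (fact L' V VA f u)+
  have so: "(1/2) * drift I f g h (Gam L u u) x - Gam L u (drift I f g h u) x = D"
    unfolding D_def by (rule drift_second_order) (fact f g h u)+
  have G: "Gam2 L' u u x = (f x)^4 * Gam2 L u u x + (f x)\<^sup>2 * Gam L u u x * ((1/2) * F)
      + 2 * (f x)^3 * Gam L f (Gam L u u) x - 2 * (f x)^3 * L u x * c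
      + f x * (f x * b) * Gam L u u x + (f x)\<^sup>2 * D"
    unfolding Gam2' so by (simp add: drift_def b_def c_def F_def)
  have L'u: "L' u x = f x * (f x * L u x + a)"
    unfolding L'[OF u] drift_def a_def by (simp add: power2_eq_square algebra_simps)
  have "(f x)\<^sup>2 * (((f x)\<^sup>2 * k x + (1/2) * F - 2 * Gam L f f x + b) * Gam L u u x
      + (- d * ((N - 2) * c + a)\<^sup>2 - (N - 2) * c\<^sup>2 + D)) + e * (L' u x)\<^sup>2 \<le> Gam2 L' u u x"
  proof (cases "f x = 0")
    case True
    then show ?thesis by (simp add: G L'u)
  next
    case False
    define R where "R = (f x)\<^sup>2 * Gam2 L u u x + 2 * f x * Gam L f (Gam L u u) x - 2 * f x * L u x * c"
    \<comment> \<open>\<open>R\<close> collects what \<open>conformal_inequality\<close> bounds; \<open>L' u = f (X + Y)\<close> for the \<open>X\<close>, \<open>Y\<close> chosen here.\<close>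
    have "e * (f x * L u x + a)\<^sup>2 \<le> (f x * L u x - (N - 2) * c)\<^sup>2 / N + d * ((N - 2) * c + a)\<^sup>2"
      using weights[of "f x * L u x - (N - 2) * c" "(N - 2) * c + a"] by (simp add: algebra_simps)
    with conformal_inequality[OF BE N u f False]
    have "((f x)\<^sup>2 * k x - 2 * Gam L f f x) * Gam L u u x - d * ((N - 2) * c + a)\<^sup>2
        - (N - 2) * c\<^sup>2 + e * (f x * L u x + a)\<^sup>2 \<le> R"
      by (simp add: c_def R_def)
    then have le: "(f x)\<^sup>2 * (((f x)\<^sup>2 * k x - 2 * Gam L f f x) * Gam L u u x - d * ((N - 2) * c + a)\<^sup>2
        - (N - 2) * c\<^sup>2 + e * (f x * L u x + a)\<^sup>2) \<le> (f x)\<^sup>2 * R"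
      by (rule mult_left_mono) simp
    have G2: "Gam2 L' u u x
        = (f x)\<^sup>2 * R + (f x)\<^sup>2 * ((1/2) * F * Gam L u u x + b * Gam L u u x + D)"
      unfolding G R_def
      by (simp add: algebra_simps power4_eq_xxxx power3_eq_cube power2_eq_square)
    have e2: "e * (L' u x)\<^sup>2 = (f x)\<^sup>2 * (e * (f x * L u x + a)\<^sup>2)"
      unfolding L'u by (simp add: power_mult_distrib)
    show ?thesis using le unfolding G2 e2 by (simp only: algebra_simps)
  qed
  then show ?thesis by (simp only: a_def b_def c_def D_def F_def diff_conv_add_uminus add.assoc)
qed

end

lemma square_sum_weights:
  fixes N :: real and M :: ereal
  assumes "0 < N" "ereal N < M"
  shows "real_of_ereal (1 / M) * (X + Y)\<^sup>2 \<le> X\<^sup>2 / N + real_of_ereal (1 / (M - ereal N)) * Y\<^sup>2"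
proof (cases M)
  case (real m)
  define D where "D = m - N"
  have D: "D > 0" "m = N + D" using assms(2) real by (auto simp: D_def)
  have "X\<^sup>2 / N + Y\<^sup>2 / D - (X + Y)\<^sup>2 / (N + D) = (D * X - N * Y)\<^sup>2 / (N * D * (N + D))"
    using assms(1) D(1) by (simp add: divide_simps) (simp add: power2_eq_square algebra_simps)
  also have "\<dots> \<ge> 0" using assms(1) D(1) by simp
  finally show ?thesis using real D assms(1) by (simp add: divide_ereal_def divide_inverse mult.commute)
next
  case PInf
  then show ?thesis using assms(1) by simp
next
  case MInf
  then show ?thesis using assms(2) by simp
qed

theorem corollary6p2:
  fixes A :: "('a \<Rightarrow> real) set"
    and L L' :: "('a \<Rightarrow> real) \<Rightarrow> 'a \<Rightarrow> real"
    and r :: nat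
    and f :: "'a \<Rightarrow> real"
    and g h :: "nat \<Rightarrow> 'a \<Rightarrow> real"
    and N :: real
    and N' :: ereal
    and k :: "'a \<Rightarrow> real"
    and k' :: "'a \<Rightarrow> ereal"
  assumes "diffusion_operator A L"
    and "f \<in> A"
    and "\<And>i. i \<in> {1..r} \<Longrightarrow> g i \<in> A"
    and "\<And>i. i \<in> {1..r} \<Longrightarrow> h i \<in> A"
    and "\<And>u. u \<in> A \<Longrightarrow>
           L' u = (\<lambda>x. (f x)\<^sup>2 * L u x + f x * (\<Sum>i=1..r. g i x * Gam L (h i) u x))"
    and "1 \<le> N"
    and "BE A L (\<lambda>x. ereal (k x)) (ereal N)"
    and "ereal N < N'"
    and "\<And>x. k' x =
           ereal ((f x)\<^sup>2 * k x + (1/2) * L (\<lambda>y. (f y)\<^sup>2) x - 2 * Gam L f f x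
                  + (\<Sum>i=1..r. g i x * Gam L (h i) f x))
           + (INF u\<in>{u \<in> A. Gam L u u x > 0}. ereal (1 / Gam L u u x *
                (- real_of_ereal (1 / (N' - ereal N))
                     * ((N - 2) * Gam L f u x + (\<Sum>i=1..r. g i x * Gam L (h i) u x))\<^sup>2
                 - (N - 2) * (Gam L f u x)\<^sup>2
                 - (\<Sum>i=1..r. f x * g i x * Hess L (h i) u u x)
                 - (\<Sum>i=1..r. Gam L (\<lambda>y. f y * g i y) u x * Gam L (h i) u x))))"
  shows "BE A L' k' N'"
proof -
  interpret diffusion A L by standard (rule assms(1))
  note f = assms(2) and g = assms(3) and h = assms(4)
  have N: "N > 0" using assms(6) by simp
  have L': "L' u = (\<lambda>x. (f x)\<^sup>2 * L u x + drift {1..r} f g h u x)" if "u \<in> A" for u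
    using assms(5)[OF that] by (simp add: drift_def)
  have Gam': "Gam L' u u x = (f x)\<^sup>2 * Gam L u u x" if "u \<in> A" for u x
  proof -
    have "drift {1..r} f g h (\<lambda>y. v y * w y) x = v x * drift {1..r} f g h w x + w x * drift {1..r} f g h v x"
      if "v \<in> A" "w \<in> A" for v w x
      by (rule drift_mult) (fact f g h that)+
    then have "Gam L' u u = (\<lambda>x. (f x)\<^sup>2 * Gam L u u x)"
      by (intro Gam_transform[where V = "drift {1..r} f g h"] L' \<open>u \<in> A\<close>)
    then show ?thesis by simp
  qed
  define e where "e = real_of_ereal (1 / N')"
  define d where "d = real_of_ereal (1 / (N' - ereal N))"
  have e: "1 / N' = ereal e"
    using assms(6,8) unfolding e_def by (cases N') (auto simp: divide_ereal_def)
  define K where "K x = (f x)\<^sup>2 * k x + (1/2) * L (\<lambda>y. (f y)\<^sup>2) x - 2 * Gam L f f x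
      + (\<Sum>i=1..r. g i x * Gam L (h i) f x)" for x
  define E where "E u x = - d * ((N - 2) * Gam L f u x + (\<Sum>i=1..r. g i x * Gam L (h i) u x))\<^sup>2
      - (N - 2) * (Gam L f u x)\<^sup>2
      - (\<Sum>i=1..r. f x * g i x * Hess L (h i) u u x)
      - (\<Sum>i=1..r. Gam L (\<lambda>y. f y * g i y) u x * Gam L (h i) u x)" for u x
  have k': "k' x = ereal (K x) + (INF u\<in>{u \<in> A. Gam L u u x > 0}. ereal (1 / Gam L u u x * E u x))" for x
    unfolding assms(9) K_def E_def d_def ..
  have bound: "(f x)\<^sup>2 * (K x * Gam L u u x + E u x) + e * (L' u x)\<^sup>2 \<le> Gam2 L' u u x"
    if "u \<in> A" for u x
    unfolding K_def E_def e_def d_def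
    by (rule Gam2_drift_lower_bound)
      (fact L' f g h assms(7) N that square_sum_weights[OF N assms(8)])+
  have curvature_term: "k' x * ereal (Gam L' u u x) \<le> ereal ((f x)\<^sup>2 * (K x * Gam L u u x + E u x))"
    if u: "u \<in> A" for u x
  proof (cases "Gam L u u x = 0")
    \<comment> \<open>Here \<open>k' x\<close> may be infinite, but it is multiplied by \<open>0\<close>.\<close>
    case True
    have "Hess L (h i) u u x = 0" if "i \<in> {1..r}" for i
      using Gam_null[OF u Gam_mem[OF h[OF that] u] True] Gam_Gam_null[OF assms(7) N u h[OF that] True]
      by (simp add: Hess_def)
    moreover have "Gam L q u x = 0" if "q \<in> A" for q
      using Gam_null[OF u that True] by (simp add: Gam_commute)
    ultimately have "E u x = 0" using f h by (simp add: E_def)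
    then show ?thesis using True by (simp add: Gam'[OF u] flip: zero_ereal_def)
  next
    case False
    then have pos: "Gam L u u x > 0" using Gam_nonneg[OF u, of x] by simp
    have "k' x \<le> ereal (K x) + ereal (1 / Gam L u u x * E u x)"
      unfolding k' using u pos by (intro add_left_mono INF_lower) simp
    then have "k' x * ereal (Gam L' u u x)
        \<le> ereal (K x + 1 / Gam L u u x * E u x) * ereal (Gam L' u u x)"
      using pos by (intro ereal_mult_right_mono) (simp_all add: Gam'[OF u])
    also have "\<dots> = ereal ((f x)\<^sup>2 * (K x * Gam L u u x + E u x))"
      using False by (simp add: Gam'[OF u] field_simps)
    finally show ?thesis .
  qed
  have "k' x * ereal (Gam L' u u x) + ereal (e * (L' u x)\<^sup>2) \<le> ereal (Gam2 L' u u x)"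
    if u: "u \<in> A" for u x
  proof -
    have "k' x * ereal (Gam L' u u x) + ereal (e * (L' u x)\<^sup>2)
        \<le> ereal ((f x)\<^sup>2 * (K x * Gam L u u x + E u x)) + ereal (e * (L' u x)\<^sup>2)"
      by (rule add_right_mono) (rule curvature_term[OF u])
    also have "\<dots> \<le> ereal (Gam2 L' u u x)"
      using bound[OF u] by simp
    finally show ?thesis .
  qed
  then show ?thesis
    unfolding BE_def e by simp
qed

end
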